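(* Let $Y$ be a Banach sequence lattice with associated Köthe space $Y^{\times}$, and let $E$ be a Banach space. Let $\rho:\ell^{Y^{\times}}(E^{*})\to\ell_0^{Y}(E)^{*}$ be the (well-defined, linear) map given by $$\rho\big(\{\varphi_n\}_{n=1}^\infty\big)\big(\{w_n\}_{n=1}^\infty\big):=\sum_{n=1}^{\infty}\varphi_n(w_n),\qquad \{\varphi_n\}\in\ell^{Y^{\times}}(E^{*}),\ \{w_n\}\in\ell_0^{Y}(E).$$ Then $\rho$ is an isometric isomorphism (of $\ell^{Y^{\times}}(E^{*})$ onto $\ell_0^{Y}(E)^{*}$).
   Context: All vector spaces are real. A Banach sequence lattice is a linear subspace $Y\subset\mathbb{R}^{\mathbb{N}}$ containing all canonical sequences $e_n$, with a complete norm $\|\cdot\|_Y$ such that if $f\in\mathbb{R}^{\mathbb{N}}$, $g\in Y$ and $|f|\le|g|$ pointwise, then $f\in Y$ and $\|f\|_Y\le\|g\|_Y$. Associated Köthe space: $Y^{\times}:=\{(\beta_n)\in\mathbb{R}^{\mathbb{N}}:\sum_n|\alpha_n\beta_n|<\infty\ \forall(\alpha_n)\in Y\}$ with norm $\|(\beta_n)\|_{Y^{\times}}:=\sup\{\sum_n|\alpha_n\beta_n|:\|(\alpha_n)\|_Y\le1\}$; it is again a Banach sequence lattice. For a Banach space $E$ and a Banach sequence lattice $Y$: $\ell^{Y}(E):=\{\{w_j\}_{j=1}^\infty\in E^{\mathbb{N}}:\{\|w_j\|_E\}_{j=1}^\infty\in Y\}$ with norm $\|\{w_j\}\|_{\ell^Y(E)}:=\|\{\|w_j\|_E\}_{j}\|_Y$.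 $\ell_{00}^{Y}(E)$ is the subspace of eventually zero sequences, and $\ell_0^{Y}(E)$ is the closure of $\ell_{00}^{Y}(E)$ in $\ell^{Y}(E)$. The space $\ell^{Y^{\times}}(E^{*})$ is defined in the same way with $Y^{\times}$, $E^{*}$ in place of $Y$, $E$. $\ell_0^{Y}(E)^{*}$ carries the dual norm. *)

theory Defs
  imports "HOL-Analysis.Analysis" "HOL-Library.Function_Algebras"
begin

(* Pointwise scalar multiplication; addition, subtraction and zero on functions are the
   pointwise ones of Function_Algebras. *)

instantiation "fun" :: (type, real_vector) real_vector
begin

definition scaleR_fun :: "real \<Rightarrow> ('a \<Rightarrow> 'b) \<Rightarrow> 'a \<Rightarrow> 'b"
  where "scaleR_fun c f = (\<lambda>x. c *\<^sub>R f x)"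

instance
  by standard (auto simp: scaleR_fun_def fun_eq_iff scaleR_add_left scaleR_add_right)

end

locale normed_subspace =
  fixes V :: "'v::real_vector set" and N :: "'v \<Rightarrow> real"
  assumes subspace: "subspace V"
    and norm_nonneg: "x \<in> V \<Longrightarrow> 0 \<le> N x"
    and norm_eq_0: "x \<in> V \<Longrightarrow> N x = 0 \<longleftrightarrow> x = 0"
    and norm_scaleR: "x \<in> V \<Longrightarrow> N (c *\<^sub>R x) = \<bar>c\<bar> * N x"
    and norm_triangle: "x \<in> V \<Longrightarrow> y \<in> V \<Longrightarrow> N (x + y) \<le> N x + N y"

locale banach_subspace = normed_subspace +
  assumes complete:
    "(\<And>n. f n \<in> V) \<Longrightarrow> (\<And>e. 0 < e \<Longrightarrow> \<exists>M. \<forall>m\<ge>M. \<forall>n\<ge>M. N (f m - f n) < e)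
      \<Longrightarrow> \<exists>g\<in>V. (\<lambda>n. N (f n - g)) \<longlonglongrightarrow> 0"

locale banach_sequence_lattice = banach_subspace Y N
  for Y :: "(nat \<Rightarrow> real) set" and N :: "(nat \<Rightarrow> real) \<Rightarrow> real" +
  assumes unit_sequence_mem: "(\<lambda>k. if k = n then 1 else 0) \<in> Y"
    and ideal_mem: "g \<in> Y \<Longrightarrow> (\<And>n. \<bar>f n\<bar> \<le> \<bar>g n\<bar>) \<Longrightarrow> f \<in> Y"
    and ideal_norm: "g \<in> Y \<Longrightarrow> (\<And>n. \<bar>f n\<bar> \<le> \<bar>g n\<bar>) \<Longrightarrow> N f \<le> N g"

definition koethe :: "(nat \<Rightarrow> real) set \<Rightarrow> (nat \<Rightarrow> real) set"
  where "koethe Y = {\<beta>. \<forall>\<alpha>\<in>Y. summable (\<lambda>n. \<bar>\<alpha> n * \<beta> n\<bar>)}"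

(* For a Banach sequence lattice Y and \<beta> in koethe Y this supremum is finite, because the
   norm of Y is complete; the value outside koethe Y is irrelevant. *)

definition koethe_norm ::
    "(nat \<Rightarrow> real) set \<Rightarrow> ((nat \<Rightarrow> real) \<Rightarrow> real) \<Rightarrow> (nat \<Rightarrow> real) \<Rightarrow> real"
  where "koethe_norm Y N \<beta> = (SUP \<alpha>\<in>{\<alpha> \<in> Y. N \<alpha> \<le> 1}. \<Sum>n. \<bar>\<alpha> n * \<beta> n\<bar>)"

definition ell :: "(nat \<Rightarrow> real) set \<Rightarrow> (nat \<Rightarrow> 'e::real_normed_vector) set"
  where "ell Y = {w. (\<lambda>j. norm (w j)) \<in> Y}"

definition ell_norm ::
    "((nat \<Rightarrow> real) \<Rightarrow> real) \<Rightarrow> (nat \<Rightarrow> 'e::real_normed_vector) \<Rightarrow> real"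
  where "ell_norm N w = N (\<lambda>j. norm (w j))"

definition ell00 :: "(nat \<Rightarrow> real) set \<Rightarrow> (nat \<Rightarrow> 'e::real_normed_vector) set"
  where "ell00 Y = {w \<in> ell Y. \<forall>\<^sub>F j in sequentially. w j = 0}"

(* The closure is taken in the norm of ell Y, not in the product topology that the type
   of functions carries. *)

definition ell0 ::
    "(nat \<Rightarrow> real) set \<Rightarrow> ((nat \<Rightarrow> real) \<Rightarrow> real) \<Rightarrow> (nat \<Rightarrow> 'e::real_normed_vector) set"
  where "ell0 Y N = {w \<in> ell Y. \<forall>e>0. \<exists>v\<in>ell00 Y. ell_norm N (w - v) < e}"

definition linear_on :: "'v::real_vector set \<Rightarrow> ('v \<Rightarrow> 'w::real_vector) \<Rightarrow> bool"
  where "linear_on V T \<longleftrightarrow>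
    (\<forall>x\<in>V. \<forall>y\<in>V. T (x + y) = T x + T y) \<and> (\<forall>c. \<forall>x\<in>V. T (c *\<^sub>R x) = c *\<^sub>R T x)"

(* A functional on the subspace V is represented by its extension by zero to the whole type;
   this makes the representation unique and the dual a linear subspace of the function type. *)

definition dual_space :: "'v::real_vector set \<Rightarrow> ('v \<Rightarrow> real) \<Rightarrow> ('v \<Rightarrow> real) set"
  where "dual_space V N =
    {L. linear_on V L \<and> (\<exists>C. \<forall>x\<in>V. \<bar>L x\<bar> \<le> C * N x) \<and> (\<forall>x. x \<notin> V \<longrightarrow> L x = 0)}"

definition dual_norm :: "'v::real_vector set \<Rightarrow> ('v \<Rightarrow> real) \<Rightarrow> ('v \<Rightarrow> real) \<Rightarrow> real"
  where "dual_norm V N L = (SUP x\<in>{x \<in> V. N x \<le> 1}. \<bar>L x\<bar>)"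

definition isometric_isomorphism ::
    "'v::real_vector set \<Rightarrow> ('v \<Rightarrow> real) \<Rightarrow> 'w::real_vector set \<Rightarrow> ('w \<Rightarrow> real) \<Rightarrow> ('v \<Rightarrow> 'w) \<Rightarrow> bool"
  where "isometric_isomorphism V N W M T \<longleftrightarrow>
    linear_on V T \<and> bij_betw T V W \<and> (\<forall>x\<in>V. M (T x) = N x)"

definition rho ::
    "(nat \<Rightarrow> real) set \<Rightarrow> ((nat \<Rightarrow> real) \<Rightarrow> real) \<Rightarrow>
      (nat \<Rightarrow> 'e::real_normed_vector \<Rightarrow>\<^sub>L real) \<Rightarrow> (nat \<Rightarrow> 'e) \<Rightarrow> real"
  where "rho Y N \<phi> w = (if w \<in> ell0 Y N then \<Sum>n. blinfun_apply (\<phi> n) (w n) else 0)"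

end

theory Submission
  imports Defs
begin

text \<open>
  Completeness of \<open>Y\<close> makes every \<open>\<beta>\<close> in the Koethe space a bounded functional: if
  \<open>\<Sum>n. \<bar>\<alpha>\<^sub>i n * \<beta> n\<bar> \<ge> 4 ^ i\<close> on the unit ball, then
  \<open>g = \<Sum>i. (1/2) ^ i * \<bar>\<alpha>\<^sub>i\<bar>\<close> lies in \<open>Y\<close> and \<open>\<Sum>n. \<bar>g n * \<beta> n\<bar>\<close> diverges. Conversely, a
  functional \<open>L\<close> on \<open>ell0\<close> bounded by \<open>C\<close> has coordinates \<open>\<phi> n x = L (x at position n)\<close>; testing
  \<open>L\<close> on finitely supported \<open>w n = \<bar>\<alpha> n\<bar> * x n\<close>, where \<open>x n\<close> almost attains the norm of \<open>\<phi> n\<close>,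
  bounds the Koethe norm of \<open>\<lambda>n. norm (\<phi> n)\<close> by \<open>C\<close>. As finitely supported sequences are dense,
  \<open>L\<close> is determined by its coordinates.
\<close>

text \<open>Stated for any type with a zero, so that it covers both the multiples of the unit
  sequences in \<open>Y\<close> and the vector-valued sequences on which functionals are
  tested.\<close>

definition single :: "nat \<Rightarrow> 'a::zero \<Rightarrow> nat \<Rightarrow> 'a"
  where "single n x = (\<lambda>k. if k = n then x else 0)"

lemma sum_fun_apply: "(\<Sum>i\<in>A. f i) x = (\<Sum>i\<in>A. f i x)"
  for f :: "'i \<Rightarrow> 'a \<Rightarrow> 'b::comm_monoid_add"
  by (induction A rule: infinite_finite_induct) auto

lemma single_add: "single n (x + y) = single n x + single n y"
  for x y :: "'a::monoid_add"
  by (auto simp: single_def fun_eq_iff)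

lemma single_scaleR: "single n (c *\<^sub>R x) = c *\<^sub>R single n x"
  for x :: "'a::real_vector"
  by (auto simp: single_def fun_eq_iff scaleR_fun_def)

lemma sum_single_eq:
  fixes w :: "nat \<Rightarrow> 'a::comm_monoid_add"
  assumes "\<And>k. m \<le> k \<Longrightarrow> w k = 0"
  shows "(\<Sum>n<m. single n (w n)) = w"
  using assms by (auto simp: sum_fun_apply single_def fun_eq_iff not_less)

text \<open>The norm is the supremum of \<open>f\<close> over the unit ball and need not be
  attained, hence the factor \<open>t < 1\<close>. If no such \<open>x\<close> existed,
  \<open>t * norm f\<close> would be an operator bound smaller than \<open>norm f\<close>.\<close>

lemma blinfun_almost_attains_norm:
  fixes f :: "'a::real_normed_vector \<Rightarrow>\<^sub>L real"
  assumes "0 \<le> t" "t < 1"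
  shows "\<exists>x. norm x \<le> 1 \<and> t * norm f \<le> blinfun_apply f x"
proof (rule ccontr)
  assume "\<not> ?thesis"
  then have *: "blinfun_apply f x < t * norm f" if "norm x \<le> 1" for x
    using that by force
  have "norm (blinfun_apply f x) \<le> t * norm f * norm x" for x
  proof (cases "x = 0")
    case False
    \<comment> \<open>Scaling to unit length and correcting the sign turns the one-sided estimate
      for \<open>y\<close> into one for the absolute value at \<open>x\<close>.\<close>
    define y where "y = (sgn (blinfun_apply f x) / norm x) *\<^sub>R x"
    have "norm y \<le> 1"
      using False by (simp add: y_def sgn_if)
    then have "blinfun_apply f y < t * norm f"
      by (rule *)
    moreover have "blinfun_apply f y = \<bar>blinfun_apply f x\<bar> / norm x"
      by (simp add: y_def blinfun.scaleR_right abs_sgn mult.commute)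
    ultimately show ?thesis
      using False by (simp add: field_simps)
  qed simp
  then have "norm f \<le> t * norm f"
    using assms by (intro norm_blinfun_bound) auto
  \<comment> \<open>The strict inequality at \<open>0\<close> rules out \<open>f = 0\<close>, so
    \<open>norm f \<le> t * norm f\<close> contradicts \<open>t < 1\<close>.\<close>
  moreover have "0 < t * norm f"
    using *[of 0] by (simp add: blinfun.zero_right)
  ultimately show False
    using assms by (auto simp: zero_less_mult_iff mult_le_cancel_right2)
qed

section \<open>The dual norm of a normed subspace\<close>

lemma dual_bdd_above:
  assumes "normed_subspace V N" "L \<in> dual_space V N"
  shows "bdd_above ((\<lambda>x. \<bar>L x\<bar>) ` {x \<in> V. N x \<le> 1})"
proof -
  interpret normed_subspace V N by fact
  from assms(2) obtain C where C: "\<And>x. x \<in> V \<Longrightarrow> \<bar>L x\<bar> \<le> C * N x"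
    by (auto simp: dual_space_def)
  show ?thesis
  \<comment> \<open>The constant in \<open>dual_space\<close> may be negative when \<open>V\<close>
    is trivial, hence its absolute value.\<close>
  proof (intro bdd_aboveI2[where M = "\<bar>C\<bar>"])
    fix z assume z: "z \<in> {x \<in> V. N x \<le> 1}"
    have "\<bar>L z\<bar> \<le> C * N z"
      using z C by simp
    also have "\<dots> \<le> \<bar>C\<bar> * 1"
      using z norm_nonneg[of z] by (intro mult_mono) auto
    finally show "\<bar>L z\<bar> \<le> \<bar>C\<bar>"
      by simp
  qed
qed

lemma dual_norm_nonneg:
  assumes "normed_subspace V N" "L \<in> dual_space V N"
  shows "0 \<le> dual_norm V N L"
proof -
  interpret normed_subspace V N by fact
  have "N 0 = 0" "0 \<in> V"
    using norm_eq_0[of 0] subspace by (auto simp: subspace_0)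
  then have "\<bar>L 0\<bar> \<le> dual_norm V N L"
    unfolding dual_norm_def by (intro cSUP_upper dual_bdd_above assms) auto
  then show ?thesis
    by linarith
qed

text \<open>Homogeneity carries the bound from the unit ball to all of \<open>V\<close>. A vector of
  norm zero cannot be rescaled; there the boundedness of \<open>L\<close> gives
  \<open>L x = 0\<close>.\<close>

lemma norm_le_dual_norm:
  assumes "normed_subspace V N" "L \<in> dual_space V N" "x \<in> V"
  shows "\<bar>L x\<bar> \<le> dual_norm V N L * N x"
proof -
  interpret normed_subspace V N by fact
  from assms(2) obtain C where lin: "linear_on V L" and C: "\<And>x. x \<in> V \<Longrightarrow> \<bar>L x\<bar> \<le> C * N x"
    by (auto simp: dual_space_def)
  show ?thesis
  proof (cases "N x = 0")
    case True
    then show ?thesis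
      using C[OF assms(3)] by simp
  next
    case False
    then have pos: "0 < N x"
      using norm_nonneg[OF assms(3)] by simp
    define y where "y = (1 / N x) *\<^sub>R x"
    have y: "y \<in> V" "N y \<le> 1"
      using assms(3) pos subspace by (auto simp: y_def norm_scaleR subspace_scale)
    have "\<bar>L y\<bar> \<le> dual_norm V N L"
      using y unfolding dual_norm_def by (intro cSUP_upper dual_bdd_above assms) auto
    moreover have "L y = L x / N x"
      using lin assms(3) by (simp add: y_def linear_on_def)
    ultimately show ?thesis
      using pos by (simp add: field_simps)
  qed
qed

lemma dual_norm_le:
  assumes "normed_subspace V N" "0 \<le> C" "\<And>x. x \<in> V \<Longrightarrow> \<bar>L x\<bar> \<le> C * N x"
  shows "dual_norm V N L \<le> C"
  unfolding dual_norm_def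
proof (intro cSUP_least)
  interpret normed_subspace V N by fact
  have "N 0 = 0" "0 \<in> V"
    using norm_eq_0[of 0] subspace by (auto simp: subspace_0)
  then show "{x \<in> V. N x \<le> 1} \<noteq> {}"
    by force
  fix x assume x: "x \<in> {x \<in> V. N x \<le> 1}"
  then have "\<bar>L x\<bar> \<le> C * N x"
    using assms(3) by simp
  also have "\<dots> \<le> C * 1"
    using x assms(2) by (intro mult_left_mono) auto
  finally show "\<bar>L x\<bar> \<le> C"
    by simp
qed

lemma linear_on_zero:
  assumes "linear_on V L" "0 \<in> V"
  shows "L 0 = 0"
  using assms unfolding linear_on_def by (metis scaleR_zero_left)

lemma linear_on_sum:
  assumes "linear_on V L" "subspace V" "\<And>i. i \<in> A \<Longrightarrow> f i \<in> V"
  shows "L (\<Sum>i\<in>A. f i) = (\<Sum>i\<in>A. L (f i))"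
  using assms(3)
proof (induction A rule: infinite_finite_induct)
  case (insert a A)
  then have "(\<Sum>i\<in>A. f i) \<in> V"
    using assms(2) by (intro subspace_sum) auto
  with insert assms(1) show ?case
    by (simp add: linear_on_def)
qed (use assms in \<open>auto simp: linear_on_zero subspace_0\<close>)

section \<open>Basic facts on Banach sequence lattices\<close>

context banach_sequence_lattice
begin

lemma abs_mem: "f \<in> Y \<Longrightarrow> (\<lambda>n. \<bar>f n\<bar>) \<in> Y"
  by (rule ideal_mem) auto

lemma norm_abs: "f \<in> Y \<Longrightarrow> N (\<lambda>n. \<bar>f n\<bar>) = N f"
  by (intro antisym ideal_norm abs_mem) auto

lemma zero_mem: "(\<lambda>_. 0) \<in> Y"
  using subspace_0[OF subspace] by (simp add: zero_fun_def)

lemma norm_zero: "N (\<lambda>_. 0) = 0"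
  using norm_eq_0[OF zero_mem] by (simp add: zero_fun_def)

lemma norm_minus: "f \<in> Y \<Longrightarrow> N (- f) = N f"
  using norm_scaleR[of f "-1"] by simp

lemma single_mem: "single n c \<in> Y"
proof -
  have "c *\<^sub>R (\<lambda>k. if k = n then 1 else 0) \<in> Y"
    using subspace unit_sequence_mem by (rule subspace_scale)
  also have "c *\<^sub>R (\<lambda>k. if k = n then 1 else 0) = single n c"
    by (auto simp: single_def scaleR_fun_def)
  finally show ?thesis .
qed

lemma finite_support_mem:
  assumes "\<And>k. m \<le> k \<Longrightarrow> f k = 0"
  shows "f \<in> Y"
proof -
  have "(\<Sum>n<m. single n (f n)) \<in> Y"
    using subspace single_mem by (intro subspace_sum) auto
  then show ?thesis
    using sum_single_eq[of m f] assms by simp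
qed

lemma norm_single_pos: "0 < N (single n 1)"
proof -
  have "single n (1::real) \<noteq> 0"
    by (auto simp: single_def fun_eq_iff)
  then show ?thesis
    using norm_eq_0[of "single n 1"] norm_nonneg[of "single n 1"] single_mem[of n 1] by simp
qed

text \<open>The restriction of \<open>f\<close> to the single index \<open>k\<close> is dominated by
  \<open>f\<close>, so monotonicity of the norm makes every coordinate functional
  continuous.\<close>

lemma abs_coordinate_le:
  assumes "f \<in> Y"
  shows "\<bar>f k\<bar> * N (single k 1) \<le> N f"
proof -
  have "\<bar>f k\<bar> * N (single k 1) = N (f k *\<^sub>R single k 1)"
    using single_mem by (simp add: norm_scaleR)
  also have "\<dots> \<le> N f"
    using assms by (intro ideal_norm) (auto simp: single_def scaleR_fun_def)
  finally show ?thesis .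
qed

text \<open>Identifies the entries of a limit that completeness provides only abstractly.\<close>

lemma coordinate_tendsto:
  assumes "\<And>n. f n \<in> Y" "g \<in> Y" "(\<lambda>n. N (f n - g)) \<longlonglongrightarrow> 0"
  shows "(\<lambda>n. f n k) \<longlonglongrightarrow> g k"
proof -
  have "\<bar>f n k - g k\<bar> \<le> N (f n - g) / N (single k 1)" for n
    using abs_coordinate_le[of "f n - g" k] assms subspace norm_single_pos[of k]
    by (simp add: subspace_diff field_simps)
  moreover have "(\<lambda>n. N (f n - g) / N (single k 1)) \<longlonglongrightarrow> 0"
    using assms(3) by (rule tendsto_divide_zero)
  ultimately have "(\<lambda>n. f n k - g k) \<longlonglongrightarrow> 0"
    using Lim_null_comparison[of "\<lambda>n. f n k - g k" "\<lambda>n. N (f n - g) / N (single k 1)"] by simp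
  then show ?thesis
    by (simp add: LIM_zero_iff)
qed

section \<open>Finiteness and basic estimates of the Koethe norm\<close>

lemma geometric_majorant:
  assumes mem: "\<And>i. f i \<in> Y" and le: "\<And>i. N (f i) \<le> 1"
  shows "\<exists>g\<in>Y. \<forall>i k. (1/2) ^ i * \<bar>f i k\<bar> \<le> g k"
proof -
  define h where "h = (\<lambda>i. (1/2::real) ^ i *\<^sub>R (\<lambda>k. \<bar>f i k\<bar>))"
  define S where "S = (\<lambda>n. \<Sum>i<n. h i)"
  define T where "T = (\<lambda>n. \<Sum>i<n. (1/2::real) ^ i)"
  have h: "h i \<in> Y" "N (h i) \<le> (1/2) ^ i" for i
    using subspace mem le[of i] abs_mem norm_abs
    by (auto simp: h_def subspace_scale norm_scaleR)
  have S: "S n \<in> Y" for n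
    unfolding S_def using subspace h by (intro subspace_sum) auto
  have T_Suc: "T (Suc m) = T m + (1/2) ^ m" for m
    by (simp add: T_def)
  \<comment> \<open>The increments of \<open>S\<close> are controlled by those of the scalar
    geometric series, so the Cauchy property passes from \<open>T\<close> to
    \<open>S\<close>.\<close>
  have inc: "N (S m - S n) \<le> T m - T n" if "n \<le> m" for m n
    using that
  proof (induction m rule: dec_induct)
    case base
    show ?case
      using norm_zero by (simp add: zero_fun_def)
  next
    case (step m)
    have "N (S (Suc m) - S n) = N ((S m - S n) + h m)"
      by (simp add: S_def algebra_simps)
    also have "\<dots> \<le> N (S m - S n) + N (h m)"
      using S h subspace by (intro norm_triangle) (auto intro: subspace_diff)
    also have "\<dots> \<le> T (Suc m) - T n"
      using step.IH h(2)[of m] T_Suc[of m] by linarith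
    finally show ?case .
  qed
  have dist: "N (S m - S n) \<le> \<bar>T m - T n\<bar>" for m n
  proof (cases "n \<le> m")
    case True
    then show ?thesis
      using inc[of n m] by simp
  next
    case False
    have "N (S m - S n) = N (S n - S m)"
      using norm_minus[of "S n - S m"] S subspace by (simp add: subspace_diff)
    then show ?thesis
      using False inc[of m n] by simp
  qed
  have "summable (\<lambda>i. (1/2::real) ^ i)"
    by (intro summable_geometric) simp
  then have "Cauchy T"
    unfolding T_def by (simp add: summable_iff_convergent convergent_Cauchy)
  then have "\<exists>M. \<forall>m\<ge>M. \<forall>n\<ge>M. N (S m - S n) < e" if "0 < e" for e
    using that dist unfolding Cauchy_def dist_real_def by (meson le_less_trans)
  then obtain g where g: "g \<in> Y" "(\<lambda>n. N (S n - g)) \<longlonglongrightarrow> 0"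
    using complete[of S] S by blast
  have "(1/2) ^ i * \<bar>f i k\<bar> \<le> g k" for i k
  proof -
    have S_eq: "S n k = (\<Sum>i<n. (1/2) ^ i * \<bar>f i k\<bar>)" for n
      by (simp add: S_def h_def sum_fun_apply scaleR_fun_def)
    \<comment> \<open>At each index the partial sums have nonnegative terms and converge to
      \<open>g k\<close>, so the limit dominates every one of them.\<close>
    have "incseq (\<lambda>n. S n k)"
      by (intro incseq_SucI) (simp add: S_eq)
    then have "S (Suc i) k \<le> g k"
      using coordinate_tendsto[OF S g] by (rule incseq_le)
    \<comment> \<open>\<open>S (Suc i)\<close> is the first partial sum that contains the term with
      index \<open>i\<close>.\<close>
    moreover have "(1/2) ^ i * \<bar>f i k\<bar> \<le> S (Suc i) k"
      unfolding S_eq by (simp add: sum_nonneg)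
    ultimately show ?thesis
      by linarith
  qed
  with g(1) show ?thesis
    by blast
qed

lemma koethe_summable: "\<beta> \<in> koethe Y \<Longrightarrow> \<alpha> \<in> Y \<Longrightarrow> summable (\<lambda>n. \<bar>\<alpha> n * \<beta> n\<bar>)"
  by (auto simp: koethe_def)

text \<open>Without this bound the real supremum in \<open>koethe_norm\<close> would carry no
  information.\<close>

lemma koethe_bdd_above:
  assumes "\<beta> \<in> koethe Y"
  shows "bdd_above ((\<lambda>\<alpha>. \<Sum>n. \<bar>\<alpha> n * \<beta> n\<bar>) ` {\<alpha> \<in> Y. N \<alpha> \<le> 1})"
proof (rule ccontr)
  assume "\<not> ?thesis"
  \<comment> \<open>The growth \<open>4 ^ i\<close> beats the weight \<open>(1/2) ^ i\<close> of the
    majorant, which leaves the unbounded lower bounds \<open>2 ^ i\<close>.\<close>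
  then have "\<exists>\<alpha>. \<alpha> \<in> Y \<and> N \<alpha> \<le> 1 \<and> 4 ^ i < (\<Sum>n. \<bar>\<alpha> n * \<beta> n\<bar>)" for i :: nat
    unfolding bdd_above_def by (simp add: not_le)
  then obtain f where f: "\<And>i. f i \<in> Y" "\<And>i. N (f i) \<le> 1"
      "\<And>i::nat. 4 ^ i < (\<Sum>n. \<bar>f i n * \<beta> n\<bar>)"
    by metis
  obtain g where g: "g \<in> Y" "\<And>i k. (1/2) ^ i * \<bar>f i k\<bar> \<le> g k"
    using geometric_majorant[of f, OF f(1,2)] by blast
  have "2 ^ i \<le> (\<Sum>n. \<bar>g n * \<beta> n\<bar>)" for i :: nat
  proof -
    have "(2::real) ^ i = (1/2) ^ i * 4 ^ i"
      by (simp flip: power_mult_distrib)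
    also have "\<dots> \<le> (1/2) ^ i * (\<Sum>n. \<bar>f i n * \<beta> n\<bar>)"
      using f(3)[of i] by simp
    also have "\<dots> = (\<Sum>n. (1/2) ^ i * \<bar>f i n * \<beta> n\<bar>)"
      using assms f(1) by (simp add: suminf_mult koethe_summable)
    also have "\<dots> \<le> (\<Sum>n. \<bar>g n * \<beta> n\<bar>)"
    proof (intro suminf_le summable_mult koethe_summable assms f(1) g(1))
      fix n
      have "(1/2) ^ i * \<bar>f i n\<bar> * \<bar>\<beta> n\<bar> \<le> \<bar>g n\<bar> * \<bar>\<beta> n\<bar>"
        using g(2)[of i n] by (intro mult_right_mono) auto
      then show "(1/2) ^ i * \<bar>f i n * \<beta> n\<bar> \<le> \<bar>g n * \<beta> n\<bar>"
        by (simp add: abs_mult)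
    qed
    finally show ?thesis .
  qed
  moreover obtain i where "(\<Sum>n. \<bar>g n * \<beta> n\<bar>) < 2 ^ i"
    using real_arch_pow[of 2] by auto
  ultimately show False
    by (meson not_le)
qed

lemma koethe_norm_nonneg:
  assumes "\<beta> \<in> koethe Y"
  shows "0 \<le> koethe_norm Y N \<beta>"
proof -
  have "(\<Sum>n. \<bar>(\<lambda>_. 0) n * \<beta> n\<bar>) \<le> koethe_norm Y N \<beta>"
    unfolding koethe_norm_def using koethe_bdd_above[OF assms]
    by (intro cSUP_upper[where x = "\<lambda>_. 0"]) (simp_all add: norm_zero zero_mem)
  then show ?thesis
    by simp
qed

text \<open>The Hoelder inequality for the pair \<open>Y\<close>, \<open>koethe Y\<close>, obtained
  by scaling a nonzero \<alpha> to norm one.\<close>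

lemma koethe_norm_bound:
  assumes "\<beta> \<in> koethe Y" "\<alpha> \<in> Y"
  shows "(\<Sum>n. \<bar>\<alpha> n * \<beta> n\<bar>) \<le> koethe_norm Y N \<beta> * N \<alpha>"
proof (cases "\<alpha> = 0")
  case False
  then have pos: "0 < N \<alpha>"
    using norm_eq_0[of \<alpha>] norm_nonneg[of \<alpha>] assms by simp
  define \<gamma> where "\<gamma> = (1 / N \<alpha>) *\<^sub>R \<alpha>"
  have "\<gamma> \<in> Y" "N \<gamma> \<le> 1"
    using assms pos subspace by (auto simp: \<gamma>_def norm_scaleR subspace_scale)
  then have "(\<Sum>n. \<bar>\<gamma> n * \<beta> n\<bar>) \<le> koethe_norm Y N \<beta>"
    unfolding koethe_norm_def using koethe_bdd_above[OF assms(1)] by (intro cSUP_upper) auto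
  moreover have "(\<Sum>n. \<bar>\<gamma> n * \<beta> n\<bar>) = (\<Sum>n. (1 / N \<alpha>) * \<bar>\<alpha> n * \<beta> n\<bar>)"
    using pos by (simp add: \<gamma>_def scaleR_fun_def abs_mult)
  moreover have "\<dots> = (1 / N \<alpha>) * (\<Sum>n. \<bar>\<alpha> n * \<beta> n\<bar>)"
    using assms by (intro suminf_mult koethe_summable)
  ultimately have "(1 / N \<alpha>) * (\<Sum>n. \<bar>\<alpha> n * \<beta> n\<bar>) \<le> koethe_norm Y N \<beta>"
    by (simp only:)
  then show ?thesis
    using pos by (simp add: pos_divide_le_eq)
qed (simp add: norm_zero zero_fun_def)

text \<open>The terms are nonnegative, so uniform bounds on finite sections yield both summability
  and the bound on the full sums. Finitely supported test sequences therefore suffice later.\<close>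

lemma koethe_norm_le:
  assumes "0 \<le> C" "\<And>\<alpha> m. \<alpha> \<in> Y \<Longrightarrow> (\<Sum>n<m. \<bar>\<alpha> n * \<beta> n\<bar>) \<le> C * N \<alpha>"
  shows "\<beta> \<in> koethe Y" "koethe_norm Y N \<beta> \<le> C"
proof -
  have sm: "summable (\<lambda>n. \<bar>\<alpha> n * \<beta> n\<bar>)" if "\<alpha> \<in> Y" for \<alpha>
    using assms(2)[OF that] by (intro summableI_nonneg_bounded) auto
  then show "\<beta> \<in> koethe Y"
    by (simp add: koethe_def)
  show "koethe_norm Y N \<beta> \<le> C"
    unfolding koethe_norm_def
  proof (intro cSUP_least)
    have "(\<lambda>_. 0) \<in> {\<alpha> \<in> Y. N \<alpha> \<le> 1}"
      by (simp add: norm_zero zero_mem)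
    then show "{\<alpha> \<in> Y. N \<alpha> \<le> 1} \<noteq> {}"
      by blast
    fix \<alpha> assume \<alpha>: "\<alpha> \<in> {\<alpha> \<in> Y. N \<alpha> \<le> 1}"
    then have "(\<Sum>n. \<bar>\<alpha> n * \<beta> n\<bar>) \<le> C * N \<alpha>"
      using sm assms(2) by (intro suminf_le_const) auto
    also have "\<dots> \<le> C * 1"
      using \<alpha> assms(1) by (intro mult_left_mono) auto
    finally show "(\<Sum>n. \<bar>\<alpha> n * \<beta> n\<bar>) \<le> C"
      by simp
  qed
qed

section \<open>The vector-valued spaces \<open>ell\<close>, \<open>ell00\<close> and
  \<open>ell0\<close>\<close>

lemma ell_add:
  assumes "v \<in> ell Y" "w \<in> ell Y"
  shows "v + w \<in> ell Y" "ell_norm N (v + w) \<le> ell_norm N v + ell_norm N w"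
proof -
  have sum: "(\<lambda>j. norm (v j)) + (\<lambda>j. norm (w j)) \<in> Y"
    using assms subspace by (auto simp: ell_def intro: subspace_add)
  \<comment> \<open>The triangle inequality for the vectors gives only a pointwise bound; the ideal
    property of \<open>Y\<close> turns it into membership and a norm estimate.\<close>
  have le: "\<bar>norm ((v + w) j)\<bar> \<le> \<bar>((\<lambda>j. norm (v j)) + (\<lambda>j. norm (w j))) j\<bar>" for j
    by (simp add: norm_triangle_ineq)
  show "v + w \<in> ell Y"
    using ideal_mem[OF sum le] by (simp add: ell_def)
  have "ell_norm N (v + w) \<le> N ((\<lambda>j. norm (v j)) + (\<lambda>j. norm (w j)))"
    unfolding ell_norm_def by (rule ideal_norm[OF sum le])
  also have "\<dots> \<le> ell_norm N v + ell_norm N w"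
    using assms unfolding ell_norm_def by (intro norm_triangle) (auto simp: ell_def)
  finally show "ell_norm N (v + w) \<le> ell_norm N v + ell_norm N w" .
qed

lemma ell_scaleR:
  assumes "w \<in> ell Y"
  shows "c *\<^sub>R w \<in> ell Y" "ell_norm N (c *\<^sub>R w) = \<bar>c\<bar> * ell_norm N w"
proof -
  have eq: "(\<lambda>j. norm ((c *\<^sub>R w) j)) = \<bar>c\<bar> *\<^sub>R (\<lambda>j. norm (w j))"
    by (simp add: scaleR_fun_def)
  show "c *\<^sub>R w \<in> ell Y"
    using assms subspace unfolding ell_def mem_Collect_eq eq by (intro subspace_scale)
  show "ell_norm N (c *\<^sub>R w) = \<bar>c\<bar> * ell_norm N w"
    using assms unfolding ell_norm_def eq by (simp add: ell_def norm_scaleR)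
qed

lemma ell_normed_subspace:
  "normed_subspace (ell Y :: (nat \<Rightarrow> 'e::real_normed_vector) set) (ell_norm N)"
proof
  show "subspace (ell Y :: (nat \<Rightarrow> 'e) set)"
    by (intro subspaceI ell_add ell_scaleR) (auto simp: ell_def zero_mem)
  fix w v :: "nat \<Rightarrow> 'e" and c :: real
  assume w: "w \<in> ell Y"
  then show "0 \<le> ell_norm N w"
    by (simp add: ell_def ell_norm_def norm_nonneg)
  show "ell_norm N w = 0 \<longleftrightarrow> w = 0"
    using w norm_eq_0[of "\<lambda>j. norm (w j)"] by (simp add: ell_def ell_norm_def fun_eq_iff)
  show "ell_norm N (c *\<^sub>R w) = \<bar>c\<bar> * ell_norm N w"
    using w by (rule ell_scaleR)
  assume "v \<in> ell Y"
  with w show "ell_norm N (w + v) \<le> ell_norm N w + ell_norm N v"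
    by (rule ell_add)
qed

lemma subspace_ell: "subspace (ell Y :: (nat \<Rightarrow> 'e::real_normed_vector) set)"
  using ell_normed_subspace by (rule normed_subspace.subspace)

lemma ell00_subset_ell: "ell00 Y \<subseteq> ell Y"
  by (auto simp: ell00_def)

lemma ell0_subset_ell: "ell0 Y N \<subseteq> ell Y"
  by (auto simp: ell0_def)

lemma subspace_ell00: "subspace (ell00 Y :: (nat \<Rightarrow> 'e::real_normed_vector) set)"
proof (rule subspaceI)
  show "0 \<in> (ell00 Y :: (nat \<Rightarrow> 'e) set)"
    using subspace_0[OF subspace_ell] by (simp add: ell00_def)
next
  fix v w :: "nat \<Rightarrow> 'e" assume "v \<in> ell00 Y" "w \<in> ell00 Y"
  then show "v + w \<in> ell00 Y"
    using ell_add(1) by (auto simp: ell00_def elim: eventually_elim2)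
next
  fix c :: real and w :: "nat \<Rightarrow> 'e" assume "w \<in> ell00 Y"
  then show "c *\<^sub>R w \<in> ell00 Y"
    using ell_scaleR(1)[of w c] by (auto simp: ell00_def scaleR_fun_def elim: eventually_mono)
qed

lemma ell00_subset_ell0: "ell00 Y \<subseteq> (ell0 Y N :: (nat \<Rightarrow> 'e::real_normed_vector) set)"
proof
  fix w :: "nat \<Rightarrow> 'e" assume w: "w \<in> ell00 Y"
  have "ell_norm N (w - w) = 0"
    using norm_zero by (simp add: ell_norm_def)
  then show "w \<in> ell0 Y N"
    using w ell00_subset_ell by (auto simp: ell0_def intro!: bexI[of _ w])
qed

text \<open>The closure of a subspace is a subspace. Since \<open>ell0\<close> is described by
  approximation, approximants are added and scaled directly.\<close>

lemma subspace_ell0: "subspace (ell0 Y N :: (nat \<Rightarrow> 'e::real_normed_vector) set)"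
proof (rule subspaceI)
  show "0 \<in> (ell0 Y N :: (nat \<Rightarrow> 'e) set)"
    using ell00_subset_ell0 subspace_0[OF subspace_ell00] by blast
next
  fix v w :: "nat \<Rightarrow> 'e" assume v: "v \<in> ell0 Y N" and w: "w \<in> ell0 Y N"
  have "\<exists>u\<in>ell00 Y. ell_norm N (v + w - u) < e" if e: "0 < e" for e
  proof -
    obtain a b where a: "a \<in> ell00 Y" "ell_norm N (v - a) < e / 2"
      and b: "b \<in> ell00 Y" "ell_norm N (w - b) < e / 2"
      using v w half_gt_zero[OF e] unfolding ell0_def by blast
    have "ell_norm N (v + w - (a + b)) = ell_norm N ((v - a) + (w - b))"
      by (simp add: algebra_simps)
    also have "\<dots> \<le> ell_norm N (v - a) + ell_norm N (w - b)"
      using v w a b ell0_subset_ell ell00_subset_ell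
      by (intro ell_add subspace_diff[OF subspace_ell]) auto
    also have "\<dots> < e"
      using a b by simp
    finally show ?thesis
      using a b subspace_add[OF subspace_ell00] by blast
  qed
  moreover have "v + w \<in> ell Y"
    using v w ell0_subset_ell by (intro ell_add) auto
  ultimately show "v + w \<in> ell0 Y N"
    by (simp add: ell0_def)
next
  fix c :: real and w :: "nat \<Rightarrow> 'e" assume w: "w \<in> ell0 Y N"
  have "\<exists>u\<in>ell00 Y. ell_norm N (c *\<^sub>R w - u) < e" if e: "0 < e" for e
  proof -
    \<comment> \<open>Adding one keeps the denominator positive when \<open>c = 0\<close>.\<close>
    have "0 < e / (\<bar>c\<bar> + 1)"
      using e by simp
    then obtain a where a: "a \<in> ell00 Y" "ell_norm N (w - a) < e / (\<bar>c\<bar> + 1)"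
      using w unfolding ell0_def by blast
    have mem: "w - a \<in> ell Y"
      using w a ell0_subset_ell ell00_subset_ell by (intro subspace_diff[OF subspace_ell]) auto
    have "ell_norm N (c *\<^sub>R w - c *\<^sub>R a) = \<bar>c\<bar> * ell_norm N (w - a)"
      using ell_scaleR(2)[OF mem, of c] by (simp add: scaleR_diff_right)
    also have "\<dots> \<le> (\<bar>c\<bar> + 1) * ell_norm N (w - a)"
      using normed_subspace.norm_nonneg[OF ell_normed_subspace mem] by (intro mult_right_mono) auto
    also have "\<dots> < e"
      using a(2) by (simp add: field_simps)
    finally show ?thesis
      using a subspace_scale[OF subspace_ell00] by blast
  qed
  moreover have "c *\<^sub>R w \<in> ell Y"
    using w ell0_subset_ell by (intro ell_scaleR) auto
  ultimately show "c *\<^sub>R w \<in> ell0 Y N"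
    by (simp add: ell0_def)
qed

lemma ell0_normed_subspace:
  "normed_subspace (ell0 Y N :: (nat \<Rightarrow> 'e::real_normed_vector) set) (ell_norm N)"
proof -
  interpret E: normed_subspace "ell Y :: (nat \<Rightarrow> 'e) set" "ell_norm N"
    by (rule ell_normed_subspace)
  show ?thesis
    using ell0_subset_ell
    by unfold_locales
      (auto simp: subspace_ell0 E.norm_nonneg E.norm_eq_0 E.norm_scaleR E.norm_triangle subset_iff)
qed

lemma finite_support_ell00:
  assumes "\<And>k. m \<le> k \<Longrightarrow> w k = 0"
  shows "w \<in> ell00 Y"
  using assms finite_support_mem[of m "\<lambda>j. norm (w j)"]
  by (auto simp: ell00_def ell_def eventually_sequentially)

lemma single_ell00: "single n x \<in> ell00 Y"
  by (rule finite_support_ell00[of "Suc n"]) (auto simp: single_def)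

lemma single_ell0: "single n x \<in> ell0 Y N"
  for x :: "'e::real_normed_vector"
  using single_ell00 ell00_subset_ell0 by blast

lemma ell_norm_single: "ell_norm N (single n x) = norm x * N (single n 1)"
proof -
  have "(\<lambda>j. norm (single n x j)) = norm x *\<^sub>R single n 1"
    by (auto simp: single_def scaleR_fun_def)
  then show ?thesis
    by (simp add: ell_norm_def norm_scaleR single_mem)
qed

section \<open>The pairing, the map \<open>rho\<close> and the coordinates of a functional\<close>

lemma pairing_bound:
  fixes \<phi> :: "nat \<Rightarrow> 'e::real_normed_vector \<Rightarrow>\<^sub>L real"
  assumes "\<phi> \<in> ell (koethe Y)" "w \<in> ell Y"
  shows "summable (\<lambda>n. blinfun_apply (\<phi> n) (w n))"
    and "\<bar>\<Sum>n. blinfun_apply (\<phi> n) (w n)\<bar> \<le> ell_norm (koethe_norm Y N) \<phi> * ell_norm N w"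
proof -
  have \<phi>: "(\<lambda>n. norm (\<phi> n)) \<in> koethe Y" and w: "(\<lambda>n. norm (w n)) \<in> Y"
    using assms by (auto simp: ell_def)
  have sm: "summable (\<lambda>n. \<bar>norm (w n) * norm (\<phi> n)\<bar>)"
    using koethe_summable[OF \<phi> w] by simp
  \<comment> \<open>The pairing is dominated term by term by that of the scalar norm sequences, to
    which \<open>koethe_norm_bound\<close> applies.\<close>
  have le: "\<bar>blinfun_apply (\<phi> n) (w n)\<bar> \<le> \<bar>norm (w n) * norm (\<phi> n)\<bar>" for n
    using norm_blinfun[of "\<phi> n" "w n"] by (simp add: mult.commute)
  have abs_sm: "summable (\<lambda>n. \<bar>blinfun_apply (\<phi> n) (w n)\<bar>)"
    using le by (intro summable_comparison_test'[OF sm]) auto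
  then show "summable (\<lambda>n. blinfun_apply (\<phi> n) (w n))"
    by (rule summable_rabs_cancel)
  have "\<bar>\<Sum>n. blinfun_apply (\<phi> n) (w n)\<bar> \<le> (\<Sum>n. \<bar>blinfun_apply (\<phi> n) (w n)\<bar>)"
    using abs_sm by (rule summable_rabs)
  also have "\<dots> \<le> (\<Sum>n. \<bar>norm (w n) * norm (\<phi> n)\<bar>)"
    using le abs_sm sm by (rule suminf_le)
  also have "\<dots> \<le> ell_norm (koethe_norm Y N) \<phi> * ell_norm N w"
    using koethe_norm_bound[OF \<phi> w] by (simp add: ell_norm_def)
  finally show "\<bar>\<Sum>n. blinfun_apply (\<phi> n) (w n)\<bar> \<le> ell_norm (koethe_norm Y N) \<phi> * ell_norm N w" .
qed

text \<open>Only one term of the series survives, so \<open>rho\<close> determines every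
  \<open>\<phi> n\<close>; injectivity rests on this.\<close>

lemma rho_single:
  "rho Y N \<phi> (single n x) = blinfun_apply (\<phi> n) x"
proof -
  have "rho Y N \<phi> (single n x) = (\<Sum>k. blinfun_apply (\<phi> k) (single n x k))"
    by (simp add: rho_def single_ell0)
  also have "\<dots> = (\<Sum>k\<in>{n}. blinfun_apply (\<phi> k) (single n x k))"
    by (rule suminf_finite) (auto simp: single_def blinfun.zero_right)
  finally show ?thesis
    by (simp add: single_def)
qed

lemma rho_bound:
  fixes \<phi> :: "nat \<Rightarrow> 'e::real_normed_vector \<Rightarrow>\<^sub>L real"
  assumes "\<phi> \<in> ell (koethe Y)" "w \<in> ell0 Y N"
  shows "\<bar>rho Y N \<phi> w\<bar> \<le> ell_norm (koethe_norm Y N) \<phi> * ell_norm N w"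
  using assms pairing_bound(2)[OF assms(1)] ell0_subset_ell by (auto simp: rho_def)

lemma ell_koethe_norm_nonneg:
  "\<phi> \<in> ell (koethe Y) \<Longrightarrow> 0 \<le> ell_norm (koethe_norm Y N) \<phi>"
  by (simp add: ell_def ell_norm_def koethe_norm_nonneg)

lemma rho_mem_dual_space:
  fixes \<phi> :: "nat \<Rightarrow> 'e::real_normed_vector \<Rightarrow>\<^sub>L real"
  assumes "\<phi> \<in> ell (koethe Y)"
  shows "rho Y N \<phi> \<in> dual_space (ell0 Y N) (ell_norm N)"
proof -
  have sm: "summable (\<lambda>n. blinfun_apply (\<phi> n) (w n))" if "w \<in> ell0 Y N" for w
    using pairing_bound(1)[OF assms] that ell0_subset_ell by blast
  have "linear_on (ell0 Y N) (rho Y N \<phi>)"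
    using subspace_add[OF subspace_ell0] subspace_scale[OF subspace_ell0] sm
    by (auto simp: linear_on_def rho_def scaleR_fun_def blinfun.add_right blinfun.scaleR_right
        suminf_add suminf_mult)
  moreover have "\<forall>w\<in>ell0 Y N. \<bar>rho Y N \<phi> w\<bar> \<le> ell_norm (koethe_norm Y N) \<phi> * ell_norm N w"
    using rho_bound[OF assms] by blast
  \<comment> \<open>The vanishing outside \<open>ell0\<close> that \<open>dual_space\<close> demands
    is built into \<open>rho\<close>.\<close>
  ultimately show ?thesis
    by (auto simp: dual_space_def rho_def)
qed

lemma linear_on_rho:
  "linear_on (ell (koethe Y)) (rho Y N :: (nat \<Rightarrow> 'e::real_normed_vector \<Rightarrow>\<^sub>L real) \<Rightarrow> _)"
proof -
  have "summable (\<lambda>n. blinfun_apply (\<phi> n) (w n))"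
    if "\<phi> \<in> ell (koethe Y)" "w \<in> ell0 Y N" for \<phi> :: "nat \<Rightarrow> 'e \<Rightarrow>\<^sub>L real" and w
    using pairing_bound(1) that ell0_subset_ell by blast
  then show ?thesis
    by (auto simp: linear_on_def rho_def fun_eq_iff scaleR_fun_def blinfun.add_left
        blinfun.scaleR_left suminf_add suminf_mult)
qed

text \<open>The reverse norm estimate, used twice: for \<open>L = rho Y N \<phi>\<close> it gives
  the lower bound in the isometry, and for an arbitrary functional it shows that the coordinates lie
  in the domain of \<open>rho\<close>.\<close>

lemma coordinates_bound:
  fixes L :: "(nat \<Rightarrow> 'e::real_normed_vector) \<Rightarrow> real" and \<phi> :: "nat \<Rightarrow> 'e \<Rightarrow>\<^sub>L real"
  assumes lin: "linear_on (ell0 Y N) L"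
    and C: "0 \<le> C" "\<And>w. w \<in> ell0 Y N \<Longrightarrow> \<bar>L w\<bar> \<le> C * ell_norm N w"
    and \<phi>: "\<And>n x. blinfun_apply (\<phi> n) x = L (single n x)"
  shows "\<phi> \<in> ell (koethe Y)" "ell_norm (koethe_norm Y N) \<phi> \<le> C"
proof -
  have "(\<Sum>n<m. \<bar>\<alpha> n * norm (\<phi> n)\<bar>) \<le> C * N \<alpha>" if \<alpha>: "\<alpha> \<in> Y" for \<alpha> m
  \<comment> \<open>The norms of the \<open>\<phi> n\<close> are only almost attained, so the
    estimate is proved with each factor \<open>t < 1\<close> and then \<open>t\<close> tends to
    one.\<close>
  proof (rule field_le_mult_one_interval)
    fix t :: real assume t: "0 < t" "t < 1"
    then have "\<forall>n. \<exists>x. norm x \<le> 1 \<and> t * norm (\<phi> n) \<le> blinfun_apply (\<phi> n) x"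
      by (intro allI blinfun_almost_attains_norm) auto
    then obtain x where x: "\<And>n. norm (x n) \<le> 1" "\<And>n. t * norm (\<phi> n) \<le> blinfun_apply (\<phi> n) (x n)"
      by metis
    \<comment> \<open>Cutting off at \<open>m\<close> puts \<open>w\<close> into
      \<open>ell00\<close>; the weights and \<open>norm (x n) \<le> 1\<close> make its norm sequence
      dominated by \<alpha>.\<close>
    define w where "w = (\<lambda>n. if n < m then \<bar>\<alpha> n\<bar> *\<^sub>R x n else 0)"
    have w: "w \<in> ell0 Y N"
      using finite_support_ell00[of m w] ell00_subset_ell0 by (auto simp: w_def)
    have norm_w: "ell_norm N w \<le> N \<alpha>"
      unfolding ell_norm_def using \<alpha> x(1)
      by (intro ideal_norm) (auto simp: w_def mult_left_le)
    have "t * (\<Sum>n<m. \<bar>\<alpha> n * norm (\<phi> n)\<bar>) = (\<Sum>n<m. \<bar>\<alpha> n\<bar> * (t * norm (\<phi> n)))"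
      by (simp add: sum_distrib_left abs_mult mult_ac)
    also have "\<dots> \<le> (\<Sum>n<m. \<bar>\<alpha> n\<bar> * blinfun_apply (\<phi> n) (x n))"
      using x(2) by (intro sum_mono mult_left_mono) auto
    also have "\<dots> = (\<Sum>n<m. L (single n (w n)))"
      by (simp add: \<phi>[symmetric] w_def blinfun.scaleR_right)
    also have "\<dots> = L (\<Sum>n<m. single n (w n))"
      by (rule linear_on_sum[symmetric, OF lin subspace_ell0 single_ell0])
    also have "\<dots> = L w"
      using sum_single_eq[of m w] by (simp add: w_def)
    also have "\<dots> \<le> C * ell_norm N w"
      using C(2)[OF w] by simp
    also have "\<dots> \<le> C * N \<alpha>"
      using norm_w C(1) by (rule mult_left_mono)
    finally show "t * (\<Sum>n<m. \<bar>\<alpha> n * norm (\<phi> n)\<bar>) \<le> C * N \<alpha>" .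
  qed
  from koethe_norm_le[OF C(1) this]
  show "\<phi> \<in> ell (koethe Y)" "ell_norm (koethe_norm Y N) \<phi> \<le> C"
    by (auto simp: ell_def ell_norm_def)
qed

section \<open>Isometry and bijectivity of \<open>rho\<close>\<close>

lemma dual_norm_rho:
  fixes \<phi> :: "nat \<Rightarrow> 'e::real_normed_vector \<Rightarrow>\<^sub>L real"
  assumes "\<phi> \<in> ell (koethe Y)"
  shows "dual_norm (ell0 Y N) (ell_norm N) (rho Y N \<phi>) = ell_norm (koethe_norm Y N) \<phi>"
proof (rule antisym)
  show "dual_norm (ell0 Y N) (ell_norm N) (rho Y N \<phi>) \<le> ell_norm (koethe_norm Y N) \<phi>"
    using assms
    by (intro dual_norm_le ell0_normed_subspace ell_koethe_norm_nonneg rho_bound)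
  show "ell_norm (koethe_norm Y N) \<phi> \<le> dual_norm (ell0 Y N) (ell_norm N) (rho Y N \<phi>)"
    using rho_mem_dual_space[OF assms]
    \<comment> \<open>The bound \<open>C\<close> is taken to be the dual norm itself; by
      \<open>rho_single\<close> the coordinates of \<open>rho Y N \<phi>\<close> are the
      \<open>\<phi> n\<close>.\<close>
    by (intro coordinates_bound(2)[where L = "rho Y N \<phi>"] dual_norm_nonneg
        norm_le_dual_norm ell0_normed_subspace)
      (auto simp: rho_single dual_space_def)
qed

text \<open>Agreement on one-entry sequences extends by linearity to \<open>ell00\<close> and by
  density and boundedness to \<open>ell0\<close>; elsewhere both functionals vanish.\<close>

lemma dual_eqI:
  fixes L M :: "(nat \<Rightarrow> 'e::real_normed_vector) \<Rightarrow> real"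
  assumes L: "L \<in> dual_space (ell0 Y N) (ell_norm N)"
    and M: "M \<in> dual_space (ell0 Y N) (ell_norm N)"
    and eq: "\<And>n x. L (single n x) = M (single n x)"
  shows "L = M"
proof
  fix w
  define A B where "A = dual_norm (ell0 Y N) (ell_norm N) L"
    and "B = dual_norm (ell0 Y N) (ell_norm N) M"
  have lin: "linear_on (ell0 Y N) L" "linear_on (ell0 Y N) M"
    using L M by (auto simp: dual_space_def)
  have A: "\<bar>L w\<bar> \<le> A * ell_norm N w" and B: "\<bar>M w\<bar> \<le> B * ell_norm N w"
    if "w \<in> ell0 Y N" for w
    using L M that unfolding A_def B_def
    by (auto intro: norm_le_dual_norm ell0_normed_subspace)
  have eq00: "L v = M v" if "v \<in> ell00 Y" for v
  proof -
    obtain m where "\<And>k. m \<le> k \<Longrightarrow> v k = 0"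
      using \<open>v \<in> ell00 Y\<close> by (auto simp: ell00_def eventually_sequentially)
    then have v: "(\<Sum>n<m. single n (v n)) = v"
      by (rule sum_single_eq)
    have "L (\<Sum>n<m. single n (v n)) = M (\<Sum>n<m. single n (v n))"
      using eq by (simp add: linear_on_sum[OF lin(1) subspace_ell0 single_ell0]
          linear_on_sum[OF lin(2) subspace_ell0 single_ell0])
    then show ?thesis
      by (simp add: v)
  qed
  show "L w = M w"
  proof (cases "w \<in> ell0 Y N")
    case w: True
    \<comment> \<open>The summand \<open>1\<close> makes \<open>K\<close> positive even if both dual
      norms are zero, so that \<open>e / K\<close> is an admissible accuracy.\<close>
    define K where "K = \<bar>A\<bar> + \<bar>B\<bar> + 1"
    have K: "0 < K" "A + B \<le> K"
      by (auto simp: K_def)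
    have "\<bar>L w - M w\<bar> \<le> 0 + e" if e: "0 < e" for e
    proof -
      obtain v where v: "v \<in> ell00 Y" "ell_norm N (w - v) < e / K"
        using w divide_pos_pos[OF e K(1)] unfolding ell0_def by blast
      have v0: "v \<in> ell0 Y N" and d: "w - v \<in> ell0 Y N"
        using v w ell00_subset_ell0 subspace_diff[OF subspace_ell0] by blast+
      have split: "F w = F v + F (w - v)" if "linear_on (ell0 Y N) F" for F :: "(nat \<Rightarrow> 'e) \<Rightarrow> real"
        using that v0 d unfolding linear_on_def by (metis add_diff_cancel_left' diff_add_cancel)
      \<comment> \<open>The contributions of \<open>v\<close> cancel, leaving only the small
        remainder \<open>w - v\<close>.\<close>
      have "\<bar>L w - M w\<bar> = \<bar>L (w - v) - M (w - v)\<bar>"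
        using split[OF lin(1)] split[OF lin(2)] eq00[OF v(1)] by simp
      also have "\<dots> \<le> (A + B) * ell_norm N (w - v)"
        using A[OF d] B[OF d] by (simp add: algebra_simps)
      also have "\<dots> \<le> K * ell_norm N (w - v)"
        using K(2) normed_subspace.norm_nonneg[OF ell0_normed_subspace d] by (rule mult_right_mono)
      also have "\<dots> \<le> e"
        using v(2) K(1) by (simp add: field_simps)
      finally show ?thesis
        by simp
    qed
    then have "\<bar>L w - M w\<bar> \<le> 0"
      by (rule field_le_epsilon)
    then show ?thesis
      by simp
  next
    case False
    then show ?thesis
      using L M by (simp add: dual_space_def)
  qed
qed

text \<open>Placing \<open>x\<close> at position \<open>n\<close> is linear and multiplies norms by
  the constant \<open>N (single n 1)\<close>, so composing it with \<open>L\<close> gives a bounded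
  functional.\<close>

lemma dual_space_coordinates:
  fixes L :: "(nat \<Rightarrow> 'e::real_normed_vector) \<Rightarrow> real"
  assumes L: "L \<in> dual_space (ell0 Y N) (ell_norm N)"
  shows "\<exists>\<phi>. \<forall>n x. blinfun_apply (\<phi> n) x = L (single n x)"
proof -
  obtain C where lin: "linear_on (ell0 Y N) L"
    and C: "\<And>w. w \<in> ell0 Y N \<Longrightarrow> \<bar>L w\<bar> \<le> C * ell_norm N w"
    using L by (auto simp: dual_space_def)
  have "bounded_linear (\<lambda>x. L (single n x))" for n
  proof (rule bounded_linear_intro)
    fix x y :: 'e and c :: real
    show "L (single n (x + y)) = L (single n x) + L (single n y)"
      using lin single_ell0 unfolding single_add linear_on_def by blast
    show "L (single n (c *\<^sub>R x)) = c *\<^sub>R L (single n x)"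
      using lin single_ell0 unfolding single_scaleR linear_on_def by blast
    show "norm (L (single n x)) \<le> norm x * (C * N (single n 1))"
      using C[OF single_ell0, of n x] by (simp add: ell_norm_single mult_ac)
  qed
  then show ?thesis
    by (intro exI[of _ "\<lambda>n. Blinfun (\<lambda>x. L (single n x))"]) (simp add: bounded_linear_Blinfun_apply)
qed

lemma bij_betw_rho:
  "bij_betw (rho Y N :: (nat \<Rightarrow> 'e::real_normed_vector \<Rightarrow>\<^sub>L real) \<Rightarrow> _) (ell (koethe Y))
    (dual_space (ell0 Y N) (ell_norm N))"
proof (rule bij_betw_imageI)
  show "inj_on (rho Y N :: (nat \<Rightarrow> 'e \<Rightarrow>\<^sub>L real) \<Rightarrow> _) (ell (koethe Y))"
    by (rule inj_onI, rule ext, rule blinfun_eqI) (metis rho_single)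
  have "L \<in> rho Y N ` ell (koethe Y)" if L: "L \<in> dual_space (ell0 Y N) (ell_norm N)"
    for L :: "(nat \<Rightarrow> 'e) \<Rightarrow> real"
  proof -
    obtain \<phi> where \<phi>: "\<And>n x. blinfun_apply (\<phi> n) x = L (single n x)"
      using dual_space_coordinates[OF L] by blast
    \<comment> \<open>Membership comes first: only then is \<open>rho Y N \<phi>\<close> known to be
      in the dual, where it can be compared with \<open>L\<close>.\<close>
    have mem: "\<phi> \<in> ell (koethe Y)"
      using L \<phi>
      by (intro coordinates_bound(1)[of L "dual_norm (ell0 Y N) (ell_norm N) L"] dual_norm_nonneg
          norm_le_dual_norm ell0_normed_subspace) (auto simp: dual_space_def)
    have "rho Y N \<phi> = L"
      using rho_mem_dual_space[OF mem] L by (rule dual_eqI) (simp add: rho_single \<phi>)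
    with mem show ?thesis
      by blast
  qed
  then show "(rho Y N :: (nat \<Rightarrow> 'e \<Rightarrow>\<^sub>L real) \<Rightarrow> _) ` ell (koethe Y)
      = dual_space (ell0 Y N) (ell_norm N)"
    using rho_mem_dual_space by auto
qed

end

theorem theorem29:
  fixes Y :: "(nat \<Rightarrow> real) set" and N :: "(nat \<Rightarrow> real) \<Rightarrow> real"
  assumes "banach_sequence_lattice Y N"
  shows "(\<forall>\<phi>\<in>(ell (koethe Y) :: (nat \<Rightarrow> 'e::banach \<Rightarrow>\<^sub>L real) set). \<forall>w\<in>ell0 Y N.
      summable (\<lambda>n. blinfun_apply (\<phi> n) (w n))) \<and>
    isometric_isomorphism
      (ell (koethe Y)) (ell_norm (koethe_norm Y N))
      (dual_space (ell0 Y N) (ell_norm N)) (dual_norm (ell0 Y N) (ell_norm N))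
      (rho Y N :: (nat \<Rightarrow> 'e \<Rightarrow>\<^sub>L real) \<Rightarrow> (nat \<Rightarrow> 'e) \<Rightarrow> real)"
proof -
  interpret banach_sequence_lattice Y N by fact
  show ?thesis
    unfolding isometric_isomorphism_def
    using pairing_bound(1) ell0_subset_ell linear_on_rho bij_betw_rho dual_norm_rho by blast
qed

end
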